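(* Let $f_1,\dots,f_n$ be nondecreasing linear functions. A permutation $\sigma$ of $[n]$ is minimum if and only if it is locally optimal.
   Context: A linear function is $f(x)=ax+b$; nondecreasing means $a\ge0$. For a permutation $\sigma$, $f^\sigma=f_{\sigma(n)}\circ\cdots\circ f_{\sigma(1)}$; $\sigma$ is minimum if $f^\sigma\le f^\rho$ pointwise for all permutations $\rho$. For $1\le\ell\le m<r\le n$, $\sigma_{\ell,m,r}$ is obtained from $\sigma$ by swapping the adjacent blocks $(\sigma(\ell),\dots,\sigma(m))$ and $(\sigma(m+1),\dots,\sigma(r))$: $\sigma_{\ell,m,r}(i)=\sigma(i)$ for $i<\ell$ or $i>r$, $=\sigma(i-\ell+m+1)$ for $\ell\le i<\ell-m+r$, $=\sigma(i+m-r)$ for $\ell-m+r\le i\le r$. $\sigma$ is locally optimal if $f^\sigma\le f^{\sigma_{\ell,m,r}}$ pointwise for all such $\ell,m,r$. *)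

theory Defs
  imports Complex_Main "HOL-Combinatorics.Permutations"
begin

text \<open>Linear functions f_i(x) = a i * x + b i, indexed by i in {1..n}.
 comp_perm a b n s x = (f_{s n} o ... o f_{s 1}) x.\<close>

definition comp_perm :: "(nat \<Rightarrow> real) \<Rightarrow> (nat \<Rightarrow> real) \<Rightarrow> nat \<Rightarrow> (nat \<Rightarrow> nat) \<Rightarrow> real \<Rightarrow> real" where
  "comp_perm a b n s x = foldl (\<lambda>y i. a (s i) * y + b (s i)) x [1..<n+1]"

definition is_minimum :: "(nat \<Rightarrow> real) \<Rightarrow> (nat \<Rightarrow> real) \<Rightarrow> nat \<Rightarrow> (nat \<Rightarrow> nat) \<Rightarrow> bool" where
  "is_minimum a b n s \<longleftrightarrow>
     (\<forall>r. r permutes {1..n} \<longrightarrow> (\<forall>x. comp_perm a b n s x \<le> comp_perm a b n r x))"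

definition block_swap :: "(nat \<Rightarrow> nat) \<Rightarrow> nat \<Rightarrow> nat \<Rightarrow> nat \<Rightarrow> nat \<Rightarrow> nat" where
  "block_swap s l m r i =
     (if i < l \<or> r < i then s i
      else if i + m < l + r then s (i + m + 1 - l)
      else s (i + m - r))"

definition locally_optimal :: "(nat \<Rightarrow> real) \<Rightarrow> (nat \<Rightarrow> real) \<Rightarrow> nat \<Rightarrow> (nat \<Rightarrow> nat) \<Rightarrow> bool" where
  "locally_optimal a b n s \<longleftrightarrow>
     (\<forall>l m r. 1 \<le> l \<and> l \<le> m \<and> m < r \<and> r \<le> n \<longrightarrow>
        (\<forall>x. comp_perm a b n s x \<le> comp_perm a b n (block_swap s l m r) x))"

end

theory Submission
  imports Defs "HOL-Combinatorics.Multiset_Permutations"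
begin

text \<open>Attach to \<open>a x + b\<close> the plane vector \<open>(b, 1 - a)\<close>. The vector of a composition is a nonnegative
  combination of those of its factors, and swapping two adjacent blocks does not help iff the
  determinant of their vectors is nonnegative. With positive slopes, local optimality thus says that
  suitably rescaled vectors are the edges of a convex polygonal path. Closing an optimal
  order by the inverse of its composition makes optimality invariant under rotation; one then shows
  that the first two functions \<open>i\<close>, \<open>j\<close> of a locally optimal order can be made adjacent in some
  optimal order, or \<open>i\<close> can be moved to its end, for otherwise another function would point strictly
  between \<open>i\<close> and \<open>j\<close>, contradicting convexity. In the first case compose the two and induct.

  If slopes vanish, only the part \<open>k # T\<close> from the last constant on matters. Replace the constant \<open>b\<close> by
  \<open>b + \<epsilon> (x - b)\<close>, whose vector is parallel to the original one so that
  \<open>T\<close> stays locally optimal behind it, and perturb the functions before it so that they strictly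
  increase every value taken along \<open>T\<close>. The same merging argument, with these
  functions as unconstrained extra elements, gives the claim up to \<open>O(\<epsilon>)\<close>.\<close>

section \<open>Slope, intercept and determinant of a composition\<close>

text \<open>A list of pairs \<open>(a, b)\<close> is composed with its head applied first.\<close>

definition slope :: "(real \<times> real) list \<Rightarrow> real" where
  "slope xs = prod_list (map fst xs)"

fun icpt :: "(real \<times> real) list \<Rightarrow> real" where
  "icpt [] = 0"
| "icpt (p # xs) = snd p * slope xs + icpt xs"

text \<open>The determinant of the vectors \<open>(icpt, 1 - slope)\<close> of \<open>U\<close> and
  \<open>V\<close>. It equals \<open>icpt (V @ U) - icpt (U @ V)\<close>, the cost of exchanging the
  two blocks.\<close>

definition cr :: "(real \<times> real) list \<Rightarrow> (real \<times> real) list \<Rightarrow> real" where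
  "cr U V = icpt U * (1 - slope V) - icpt V * (1 - slope U)"

definition swap_opt :: "(real \<times> real) list \<Rightarrow> bool" where
  "swap_opt xs \<longleftrightarrow> (\<forall>P U V Q. xs = P @ U @ V @ Q \<longrightarrow> cr U V \<ge> 0)"

lemma slope_simps [simp]:
  "slope [] = 1" "slope (p # xs) = fst p * slope xs" "slope (xs @ ys) = slope xs * slope ys"
  by (auto simp: slope_def)

lemma icpt_append [simp]: "icpt (xs @ ys) = slope ys * icpt xs + icpt ys"
  by (induction xs) (auto simp: algebra_simps)

lemma slope_pos: "(\<And>p. p \<in> set xs \<Longrightarrow> fst p > 0) \<Longrightarrow> slope xs > 0"
  by (induction xs) auto

lemma slope_mset: "mset xs = mset ys \<Longrightarrow> slope xs = slope ys"
  unfolding slope_def by (metis mset_map prod_mset_prod_list)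

lemma foldl_linear: "foldl (\<lambda>y p. fst p * y + snd p) x xs = slope xs * x + icpt xs"
  by (induction xs arbitrary: x) (auto simp: algebra_simps)

lemma icpt_swap: "icpt (P @ V @ U @ Q) = icpt (P @ U @ V @ Q) + slope Q * cr U V"
  by (simp add: cr_def algebra_simps)

text \<open>The vector of \<open>U @ V\<close> is \<open>slope V\<close> times that of
  \<open>U\<close> plus that of \<open>V\<close>, and the determinant is linear in it.\<close>

lemma cr_append_right: "cr W (U @ V) = cr W V + slope V * cr W U"
  by (simp add: cr_def algebra_simps)

lemma cr_Nil [simp]: "cr [] U = 0" "cr U [] = 0"
  by (simp_all add: cr_def)

lemma cr_self [simp]: "cr U U = 0"
  by (simp add: cr_def)

lemma cr_commute: "cr U V = - cr V U"
  by (simp add: cr_def)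

lemma cr_Cons_right: "cr W (p # V) = cr W V + slope V * cr W [p]"
  using cr_append_right[of W "[p]" V] by simp

lemma swap_optD: "swap_opt (P @ U @ V @ Q) \<Longrightarrow> cr U V \<ge> 0"
  by (auto simp: swap_opt_def)

text \<open>If \<open>xs\<close> followed by \<open>ys\<close> is the identity, the two compositions
  are inverse to each other and hence also cancel in the other order.\<close>

lemma icpt_rotate_eq_0:
  assumes "slope (xs @ ys) = 1" "icpt (xs @ ys) = 0"
  shows "icpt (ys @ xs) = 0"
proof -
  have "icpt (ys @ xs) = slope xs * icpt (xs @ ys)"
    using assms(1) by (simp add: algebra_simps)
  then show ?thesis using assms(2) by simp
qed

section \<open>Convexity, closed arrangements and merging\<close>

text \<open>The polygon with edges parallel to \<open>(icpt, 1 - slope)\<close> of the single functions is convex,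
  so no edge direction lies strictly between two consecutive ones.\<close>

lemma swap_opt_no_direction_between:
  assumes opt: "swap_opt (P @ i # j # Q)" and y: "y \<in> set Q"
    and ij: "cr [i] [j] > 0"
  shows "\<not> (cr [i] [y] > 0 \<and> cr [y] [j] > 0)"
proof
  assume iy: "cr [i] [y] > 0 \<and> cr [y] [j] > 0"
  obtain Y1 Y2 where Q: "Q = Y1 @ y # Y2" using y by (meson split_list)
  let ?v = "j # Y1"
  have 1: "cr [j] Y1 \<ge> 0" by (rule swap_optD[of "P @ [i]" _ _ "y # Y2"]) (use opt Q in simp)
  have 2: "cr [i] ?v \<ge> 0" by (rule swap_optD[of "P" _ _ "y # Y2"]) (use opt Q in simp)
  have 3: "cr ?v [y] \<ge> 0" by (rule swap_optD[of "P @ [i]" _ _ "Y2"]) (use opt Q in simp)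
  have 4: "cr [j] (Y1 @ [y]) \<ge> 0" by (rule swap_optD[of "P @ [i]" _ _ "Y2"]) (use opt Q in simp)
  have jv: "cr [j] ?v \<ge> 0" using 1 by (simp add: cr_Cons_right[of "[j]" j Y1])
  \<comment> \<open>A Pluecker relation. The left side is nonnegative and the right side
    nonpositive, so every term vanishes; hence \<open>Y1\<close> is parallel to \<open>j\<close>,
    and \<open>4\<close> then forbids \<open>y\<close> to lie on the wrong side of
    \<open>j\<close>.\<close>
  have "cr ?v [y] * cr [i] [j] = - (cr [y] [j] * cr [i] ?v + cr [i] [y] * cr [j] ?v)"
    by (simp add: cr_def algebra_simps)
  moreover have "cr ?v [y] * cr [i] [j] \<ge> 0" "cr [y] [j] * cr [i] ?v \<ge> 0" "cr [i] [y] * cr [j] ?v \<ge> 0"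
    using 2 3 ij iy jv by auto
  ultimately have "cr [i] [y] * cr [j] ?v = 0" by linarith
  then have "cr [j] ?v = 0" using iy by simp
  then have "cr [j] Y1 = 0" by (simp add: cr_Cons_right[of "[j]" j Y1])
  then have "cr [j] [y] \<ge> 0" using 4 by (simp add: cr_append_right)
  then show False using iy cr_commute[of "[j]" "[y]"] by simp
qed

text \<open>\<open>N\<close> collects functions whose composition is at least the identity in every order; being the
  identity is then invariant under rotation of the order. Take an identity arrangement
  \<open>i # x # W @ j # V\<close> with the block between \<open>i\<close> and \<open>j\<close> as short as possible: a vanishing \<open>cr\<close>
  would allow a commutation that shortens it.\<close>

lemma closed_arrangement_separating_block:
  assumes pos: "\<forall>p \<in># N. fst p > 0"
    and slope1: "\<forall>xs. mset xs = N \<longrightarrow> slope xs = 1"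
    and nonneg: "\<forall>xs. mset xs = N \<longrightarrow> icpt xs \<ge> 0"
    and ex: "mset xs0 = N" "icpt xs0 = 0"
    and i: "i \<in># N" and j: "j \<in># N - {#i#}"
    and nonadj: "\<forall>V. mset (i # j # V) = N \<longrightarrow> icpt (i # j # V) \<noteq> 0"
  shows "\<exists>x W V. mset (i # x # W @ j # V) = N \<and> icpt (i # x # W @ j # V) = 0 \<and>
    cr [i] (x # W) > 0 \<and> cr (x # W) [j] > 0 \<and>
    cr [i] [x] > 0 \<and> cr [x] W \<ge> 0"
proof -
  define closed where "closed xs \<longleftrightarrow> mset xs = N \<and> icpt xs = 0" for xs
  have rot: "closed (ys @ xs)" if "closed (xs @ ys)" for xs ys
    using that icpt_rotate_eq_0[of xs ys] slope1[rule_format, of "xs @ ys"] by (auto simp: closed_def add.commute)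
  \<comment> \<open>A block swap of an identity arrangement is again an arrangement of
    \<open>N\<close>, so its intercept cannot become negative, and it stays zero if
    \<open>cr U V\<close> vanishes.\<close>
  have swap: "cr U V \<ge> 0 \<and> (cr U V = 0 \<longrightarrow> closed (P @ V @ U @ Q))"
    if "closed (P @ U @ V @ Q)" for P U V Q
  proof -
    have m: "mset (P @ V @ U @ Q) = N" using that by (simp add: closed_def add_ac)
    have "set Q \<subseteq> set_mset N" using that by (auto simp: closed_def)
    then have "slope Q > 0" using pos by (intro slope_pos) auto
    moreover have "slope Q * cr U V \<ge> 0"
      using nonneg[rule_format, OF m] that icpt_swap[of P V U Q] by (simp add: closed_def)
    ultimately have "cr U V \<ge> 0" by (simp add: zero_le_mult_iff)
    moreover have "closed (P @ V @ U @ Q)" if "cr U V = 0"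
      using \<open>closed (P @ U @ V @ Q)\<close> m icpt_swap[of P V U Q] that by (simp add: closed_def)
    ultimately show ?thesis by simp
  qed
  define Q where "Q W \<longleftrightarrow> (\<exists>V. closed (i # W @ j # V))" for W
  have "\<exists>W. Q W"
  proof -
    from i ex(1) have "i \<in> set xs0" by (metis set_mset_mset)
    then obtain A B where AB: "xs0 = A @ i # B" by (meson split_list)
    have c: "closed ((i # B) @ A)" using rot[of A "i # B"] ex AB by (simp add: closed_def)
    then have "mset (B @ A) = N - {#i#}" by (auto simp: closed_def)
    with j have "j \<in> set (B @ A)" by (metis set_mset_mset)
    then obtain W V where "B @ A = W @ j # V" by (meson split_list)
    with c show ?thesis by (auto simp: Q_def)
  qed
  then obtain W0 where W0: "Q W0" and min: "\<And>W'. Q W' \<Longrightarrow> length W0 \<le> length W'"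
    using ex_has_least_nat[of Q _ length] by blast
  from W0 obtain V where cl: "closed (i # W0 @ j # V)" by (auto simp: Q_def)
  have ne: "W0 \<noteq> []" using cl nonadj by (auto simp: closed_def)
  then obtain x W where W: "W0 = x # W" by (cases W0) auto
  have notQ: "\<not> Q []" using nonadj by (auto simp: Q_def closed_def)
  have 1: "cr [i] W0 > 0"
  proof -
    have "cr [i] W0 \<noteq> 0"
    proof
      assume "cr [i] W0 = 0"
      then have "closed (W0 @ i # j # V)" using swap[of "[]" "[i]" W0 "j # V"] cl by simp
      then have "closed (i # j # V @ W0)" using rot[of W0 "i # j # V"] by simp
      then show False using notQ by (auto simp: Q_def)
    qed
    then show ?thesis using swap[of "[]" "[i]" W0 "j # V"] cl by simp
  qed
  have 2: "cr W0 [j] > 0"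
  proof -
    have "cr W0 [j] \<noteq> 0"
    proof
      assume "cr W0 [j] = 0"
      then have "closed (i # j # W0 @ V)" using swap[of "[i]" W0 "[j]" V] cl by simp
      then show False using notQ by (auto simp: Q_def)
    qed
    then show ?thesis using swap[of "[i]" W0 "[j]" V] cl by simp
  qed
  have 3: "cr [i] [x] > 0"
  proof -
    have "cr [i] [x] \<noteq> 0"
    proof
      assume "cr [i] [x] = 0"
      \<comment> \<open>\<open>x\<close> commutes with \<open>i\<close>, so it may go in front of
        \<open>i\<close> and from there be rotated to the end, which leaves the shorter block
        \<open>W\<close>.\<close>
      then have "closed ([x] @ i # W @ j # V)" using swap[of "[]" "[i]" "[x]" "W @ j # V"] cl W by simp
      from rot[OF this] have "Q W" by (auto simp: Q_def)
      then show False using min W by fastforce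
    qed
    then show ?thesis using swap[of "[]" "[i]" "[x]" "W @ j # V"] cl W by simp
  qed
  have 4: "cr [x] W \<ge> 0" using swap[of "[i]" "[x]" W "j # V"] cl W by simp
  show ?thesis using 1 2 3 4 cl unfolding W closed_def by (intro exI[of _ x] exI[of _ W] exI[of _ V]) simp
qed

text \<open>The merged function has the vector of the pair, so its swaps are those swaps of
  \<open>i # j # Q\<close> that keep \<open>i\<close> and \<open>j\<close> together.\<close>

lemma swap_opt_merge:
  assumes "swap_opt (i # j # Q)"
  shows "swap_opt ((slope [i, j], icpt [i, j]) # Q)"
  unfolding swap_opt_def
proof (intro allI impI)
  fix A U V B
  let ?k = "(slope [i, j], icpt [i, j])"
  have k: "slope (?k # Y) = slope (i # j # Y)" "icpt (?k # Y) = icpt (i # j # Y)" for Y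
    by (simp_all add: algebra_simps)
  assume eq: "?k # Q = A @ U @ V @ B"
  \<comment> \<open>The merged function lies before \<open>U\<close> or heads it; if
    \<open>A\<close> and \<open>U\<close> are both empty it falls into a later block, but then
    \<open>cr U V\<close> is zero.\<close>
  consider Z where "Q = Z @ U @ V @ B" | "U = []"
    | Z where "U = ?k # Z" "Q = Z @ V @ B"
    using eq by (cases A; cases U) auto
  then show "cr U V \<ge> 0"
  proof cases
    case 1
    then show ?thesis using assms by (intro swap_optD[of "i # j # Z" _ _ B]) simp
  next
    case (3 Z)
    then have "cr (i # j # Z) V \<ge> 0"
      using assms by (intro swap_optD[of "[]" _ _ B]) simp
    then show ?thesis unfolding 3 cr_def k .
  qed simp
qed

lemma cr_pluecker: "cr A B * cr C D + cr A D * cr B C = cr A C * cr B D"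
  by (simp add: cr_def algebra_simps)

text \<open>The block \<open>W\<close> only certifies that \<open>i\<close> and \<open>j\<close> point in opposite, nonzero directions.\<close>

lemma swap_opt_antiparallel:
  assumes opt: "swap_opt (i # j # Q)"
    and ij: "cr [i] [j] = 0" and W: "cr [i] W > 0" "cr W [j] > 0" and x: "x \<in> set Q"
  shows "cr [i] [x] = 0"
proof -
  \<comment> \<open>By the Pluecker relation, \<open>cr [i]\<close> and \<open>cr [j]\<close> have
    opposite signs on every block.\<close>
  have opp: "cr [i] W * cr [j] Z = - (cr W [j] * cr [i] Z)" for Z
    using cr_pluecker[of "[i]" "[j]" W Z] ij by (simp add: cr_commute[of W "[j]"] mult.commute)
  have Q: "cr [i] Z = 0" if Z: "Q = Z @ Z'" for Z Z'
  proof -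
    have "cr [i] (j # Z) \<ge> 0" by (rule swap_optD[of "[]" _ _ Z']) (use opt Z in simp)
    moreover have "cr [j] Z \<ge> 0" by (rule swap_optD[of "[i]" _ _ Z']) (use opt Z in simp)
    then have "cr W [j] * cr [i] Z \<le> 0"
      using opp[of Z] W(1) by (metis less_imp_le mult_nonneg_nonneg neg_0_le_iff_le)
    then have "cr [i] Z \<le> 0" using W(2) by (simp add: mult_le_0_iff)
    ultimately show ?thesis using ij by (simp add: cr_Cons_right[of _ j Z])
  qed
  \<comment> \<open>Every prefix of \<open>Q\<close> is parallel to \<open>i\<close>; comparing the
    prefixes that end just before and just after \<open>x\<close> isolates \<open>x\<close>.\<close>
  obtain Z Z' where Z: "Q = Z @ x # Z'" using x by (meson split_list)
  then show ?thesis using Q[of Z "x # Z'"] Q[of "Z @ [x]" Z'] by (simp add: cr_append_right)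
qed

subsection \<open>Positive slopes\<close>

lemma ex_minimal_arrangement:
  obtains ys where "mset ys = M" "\<And>zs. mset zs = M \<Longrightarrow> icpt ys \<le> icpt zs"
proof -
  have "\<exists>ys. is_arg_min icpt (\<lambda>ys. ys \<in> permutations_of_multiset M) ys"
    using ex_is_arg_min_if_finite[of "permutations_of_multiset M" icpt] by auto
  then show ?thesis
    using that by (auto simp: is_arg_min_linorder permutations_of_multiset_def)
qed

definition best :: "(real \<times> real) multiset \<Rightarrow> (real \<times> real) list \<Rightarrow> bool" where
  "best M ys \<longleftrightarrow> mset ys = M \<and> (\<forall>zs. mset zs = M \<longrightarrow> icpt ys \<le> icpt zs)"

text \<open>In the second case, the element right after \<open>i\<close> in the closed arrangement is the
  inverse \<open>g\<close> that was added to close it.\<close>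

lemma best_adjacent_or_last_or_between:
  assumes pos: "\<forall>p \<in># M. fst p > 0" and M: "i \<in># M" "j \<in># M - {#i#}" and ij: "cr [i] [j] \<ge> 0"
  obtains X Y where "best M (X @ i # j # Y)" | Z where "best M (Z @ [i])"
  | x W where "x \<in># M" "cr [i] [x] > 0" "cr [i] [j] > 0 \<Longrightarrow> cr [x] [j] > 0"
      "cr [i] W > 0" "cr W [j] > 0"
proof -
  obtain ys where ys: "mset ys = M" and min: "\<And>zs. mset zs = M \<Longrightarrow> icpt ys \<le> icpt zs"
    using ex_minimal_arrangement[of M] by blast
  define A where "A = slope ys"
  have A: "A > 0" unfolding A_def by (rule slope_pos) (use pos ys in auto)
  \<comment> \<open>The inverse of the composition of \<open>ys\<close>.\<close>
  define g where "g = (1 / A, - icpt ys / A)"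
  define N where "N = add_mset g M"
  have posN: "\<forall>p \<in># N. fst p > 0"
    using pos A by (auto simp: N_def g_def)
  have slopeN: "\<forall>zs. mset zs = N \<longrightarrow> slope zs = 1"
  proof (intro allI impI)
    fix zs assume "mset zs = N"
    then show "slope zs = 1"
      using slope_mset[of zs "ys @ [g]"] A ys by (simp add: N_def g_def A_def)
  qed
  \<comment> \<open>Cutting a cyclic arrangement at \<open>g\<close> turns its intercept, up to the
    factor \<open>slope X\<close>, into the excess of \<open>Y @ X\<close> over the minimum. Closed
    arrangements of \<open>N\<close> are thus the optimal orders of \<open>M\<close>.\<close>
  have split: "mset (Y @ X) = M" "slope X * icpt (X @ g # Y) = icpt (Y @ X) - icpt ys"
    if "mset (X @ g # Y) = N" for X Y
  proof -
    show m: "mset (Y @ X) = M" using that by (simp add: N_def add.commute)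
    have "A = slope Y * slope X" using slope_mset[of "Y @ X" ys] m ys by (simp add: A_def)
    moreover from this have "slope X \<noteq> 0" "slope Y \<noteq> 0" using A by auto
    ultimately show "slope X * icpt (X @ g # Y) = icpt (Y @ X) - icpt ys"
      by (simp add: g_def field_simps)
  qed
  have nonneg: "\<forall>zs. mset zs = N \<longrightarrow> icpt zs \<ge> 0"
  proof (intro allI impI)
    fix zs assume zs: "mset zs = N"
    have "g \<in> set zs" using zs by (metis N_def set_mset_mset union_single_eq_member)
    then obtain X Y where XY: "zs = X @ g # Y" by (meson split_list)
    have "set X \<subseteq> set_mset N" using zs XY by auto
    then have "slope X > 0" using posN by (intro slope_pos) auto
    moreover have "slope X * icpt zs \<ge> 0" using split[of X Y] zs XY min[of "Y @ X"] by simp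
    ultimately show "icpt zs \<ge> 0" by (simp add: zero_le_mult_iff)
  qed
  have ex: "mset (ys @ [g]) = N" "icpt (ys @ [g]) = 0"
    using ys A by (simp_all add: N_def g_def)
  have cut: "best M (Y @ X)" if "mset (X @ g # Y) = N" "icpt (X @ g # Y) = 0" for X Y
    using split[of X Y] that min unfolding best_def by simp
  have iN: "i \<in># N" and jN: "j \<in># N - {#i#}"
    using M by (auto simp: N_def)
  show thesis
  proof (cases "\<exists>V. mset (i # j # V) = N \<and> icpt (i # j # V) = 0")
    case True
    then obtain V where V: "mset (i # j # V) = N" "icpt (i # j # V) = 0" by blast
    obtain M' where M': "M = add_mset i (add_mset j M')"
      using M by (metis insert_DiffM)
    have "mset V = add_mset g M'" using V(1) M' by (simp add: N_def)
    then have "g \<in> set V" by (metis set_mset_mset union_single_eq_member)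
    then obtain V1 V2 where "V = V1 @ g # V2" by (meson split_list)
    then have "best M (V2 @ i # j # V1)" using cut[of "i # j # V1" V2] V by simp
    then show thesis by (rule that(1))
  next
    case False
    then obtain x W V where W: "mset (i # x # W @ j # V) = N" "icpt (i # x # W @ j # V) = 0"
      "cr [i] (x # W) > 0" "cr (x # W) [j] > 0" "cr [i] [x] > 0" "cr [x] W \<ge> 0"
      using closed_arrangement_separating_block[OF posN slopeN nonneg ex iN jN] by blast
    show thesis
    proof (cases "x = g")
      case True
      then have "best M ((W @ j # V) @ [i])" using cut[of "[i]" "W @ j # V"] W(1,2) by simp
      then show thesis by (rule that(2))
    next
      case False
      then have "x \<in># M" using W(1) by (auto simp: N_def add_eq_conv_ex)
      moreover have "cr [x] [j] > 0" if "cr [i] [j] > 0"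
      proof (rule ccontr)
        assume "\<not> cr [x] [j] > 0"
        \<comment> \<open>A Pluecker relation: if \<open>cr [x] [j]\<close> were not positive, its
          right side would be negative and its left side nonnegative.\<close>
        moreover have "cr [x] (x # W) * cr [i] [j] = cr [i] (x # W) * cr [x] [j] - cr (x # W) [j] * cr [i] [x]"
          by (simp add: cr_def algebra_simps)
        moreover have "cr [x] (x # W) * cr [i] [j] \<ge> 0"
          using W(6) ij by (simp add: cr_Cons_right[of "[x]" x W])
        moreover have "cr (x # W) [j] * cr [i] [x] > 0" using W by simp
        moreover have "cr [i] (x # W) * cr [x] [j] \<le> 0"
          using W(3) calculation(1) by (simp add: mult_le_0_iff)
        ultimately show False by linarith
      qed
      ultimately show thesis using that(3) W by blast
    qed
  qed
qed

text \<open>The elements of \<open>R\<close> are arbitrary except that they never point to the left of a prefix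
  of \<open>S\<close>; this keeps them from separating \<open>i\<close> and \<open>j\<close> when the head pair of \<open>S\<close> is merged.\<close>

lemma swap_opt_contiguous_or_last:
  assumes "swap_opt S" "\<forall>p \<in> set S. fst p > 0" "\<forall>p \<in># R. fst p > 0"
    and "\<forall>S1 S2. \<forall>r \<in># R. S = S1 @ S2 \<and> S1 \<noteq> [] \<longrightarrow> cr S1 [r] \<le> 0"
    and "mset ys = mset S + R"
  shows "(\<exists>X Y. mset (X @ Y) = R \<and> icpt (X @ S @ Y) \<le> icpt ys) \<or>
    (\<exists>S1 S2 Z. S = S1 @ S2 \<and> S1 \<noteq> [] \<and> mset Z = mset S2 + R \<and> icpt (Z @ S1) \<le> icpt ys)"
  using assms
proof (induction "length S" arbitrary: S ys rule: less_induct)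
  case (less S)
  note prems = less.prems
  consider "S = []" | i where "S = [i]" | i j Q where "S = i # j # Q"
    by (metis neq_Nil_conv)
  then show ?case
  proof cases
    case 1
    then show ?thesis using prems(5) by (intro disjI1 exI[of _ ys] exI[of _ "[]"]) simp
  next
    case (2 i)
    then have "i \<in> set ys" using prems(5) by (metis list.set_intros(1) set_mset_mset union_iff)
    then obtain X Y where "ys = X @ i # Y" by (meson split_list)
    then show ?thesis using prems(5) 2 by (intro disjI1 exI[of _ X] exI[of _ Y]) simp
  next
    case S: (3 i j Q)
    have M: "i \<in># mset ys" "j \<in># mset ys - {#i#}" and pos: "\<forall>p \<in># mset ys. fst p > 0"
      unfolding prems(5) using S prems(2,3) by auto
    have ij: "cr [i] [j] \<ge> 0" by (rule swap_optD[of "[]" _ _ Q]) (use prems(1) S in simp)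
    from pos M ij show ?thesis
    proof (cases rule: best_adjacent_or_last_or_between)
      case (1 X Y)
      let ?k = "(slope [i, j], icpt [i, j])"
      have k: "slope (A @ ?k # B) = slope (A @ i # j # B)" "icpt (A @ ?k # B) = icpt (A @ i # j # B)" for A B
        by (simp_all add: algebra_simps)
      have k': "slope (?k # B) = slope (i # j # B)" "icpt (?k # B) = icpt (i # j # B)" for B
        using k[of "[]" B] by simp_all
      have XY: "icpt (X @ ?k # Y) \<le> icpt ys" unfolding k using 1 by (simp add: best_def)
      have "(\<exists>A B. mset (A @ B) = R \<and> icpt (A @ (?k # Q) @ B) \<le> icpt (X @ ?k # Y)) \<or>
        (\<exists>S1 S2 Z. ?k # Q = S1 @ S2 \<and> S1 \<noteq> [] \<and> mset Z = mset S2 + R \<and> icpt (Z @ S1) \<le> icpt (X @ ?k # Y))"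
      proof (rule less.hyps)
        show "length (?k # Q) < length S" by (simp add: S)
        show "swap_opt (?k # Q)" using prems(1) unfolding S by (rule swap_opt_merge)
        show "\<forall>p \<in> set (?k # Q). fst p > 0" using prems(2) by (auto simp: S)
        show "\<forall>p \<in># R. fst p > 0" by fact
        show "mset (X @ ?k # Y) = mset (?k # Q) + R"
          using 1 prems(5) by (simp add: best_def S)
        show "\<forall>S1 S2. \<forall>r \<in># R. ?k # Q = S1 @ S2 \<and> S1 \<noteq> [] \<longrightarrow> cr S1 [r] \<le> 0"
        proof (intro allI ballI impI)
          fix S1 S2 r assume r: "r \<in># R" and S12: "?k # Q = S1 @ S2 \<and> S1 \<noteq> []"
          then obtain S1' where S1': "S1 = ?k # S1'" "Q = S1' @ S2" by (cases S1) auto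
          have "cr (i # j # S1') [r] \<le> 0"
            using prems(4)[rule_format, OF r, of "i # j # S1'" S2] S S1' by simp
          then show "cr S1 [r] \<le> 0" unfolding S1' cr_def k' .
        qed
      qed
      then show ?thesis
      proof (elim disjE exE conjE)
        fix A B assume "mset (A @ B) = R" "icpt (A @ (?k # Q) @ B) \<le> icpt (X @ ?k # Y)"
        moreover have "icpt (A @ (?k # Q) @ B) = icpt (A @ S @ B)"
          unfolding S using k(2)[of A "Q @ B"] by simp
        ultimately show ?thesis using XY by (intro disjI1 exI[of _ A] exI[of _ B]) simp
      next
        fix S1 S2 Z assume *: "?k # Q = S1 @ S2" "S1 \<noteq> []" "mset Z = mset S2 + R"
          "icpt (Z @ S1) \<le> icpt (X @ ?k # Y)"
        then obtain S1' where S1': "S1 = ?k # S1'" "Q = S1' @ S2" by (cases S1) auto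
        have "icpt (Z @ i # j # S1') \<le> icpt ys" using *(4) XY unfolding S1' k by simp
        then show ?thesis using * S1' S
          by (intro disjI2 exI[of _ "i # j # S1'"] exI[of _ S2] exI[of _ Z]) simp
      qed
    next
      case (2 Z)
      then have "mset Z = mset (j # Q) + R" "icpt (Z @ [i]) \<le> icpt ys"
        using prems(5) by (simp_all add: best_def S)
      then show ?thesis using S
        by (intro disjI2 exI[of _ "[i]"] exI[of _ "j # Q"] exI[of _ Z]) simp
    next
      case (3 x W)
      \<comment> \<open>The prefix \<open>[i]\<close> of \<open>S\<close> has no element of
        \<open>R\<close> to its left, whereas \<open>cr [i] [x]\<close> is positive.\<close>
      have "x \<notin># R" using prems(4)[rule_format, of x "[i]" "j # Q"] 3(2) S by auto
      moreover have "x \<noteq> i" using 3(2) by auto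
      moreover have "x \<noteq> j"
        using 3(2,3) by auto
      \<comment> \<open>For \<open>cr [i] [j] > 0\<close> convexity excludes a direction between
        \<open>i\<close> and \<open>j\<close>; for \<open>cr [i] [j] = 0\<close> all of
        \<open>Q\<close> is parallel to \<open>i\<close>.\<close>
      moreover have "x \<notin> set Q"
        using swap_opt_antiparallel[of i j Q W x] swap_opt_no_direction_between[of "[]" i j Q x]
          3 ij prems(1) S by force
      ultimately have False using 3(1) prems(5) S by auto
      then show ?thesis ..
    qed
  qed
qed

text \<open>With no extra elements, either \<open>xs\<close> itself is at least as good as
  \<open>ys\<close>, or some order ending in a nonempty prefix \<open>S1\<close> is. In the latter
  case the rest \<open>S2\<close> is optimal by induction, and swapping \<open>S1\<close> back to
  the front does not raise the intercept.\<close>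

theorem swap_opt_imp_minimal:
  assumes "swap_opt xs" "\<forall>p \<in> set xs. fst p > 0" "mset ys = mset xs"
  shows "icpt xs \<le> icpt ys"
  using assms
proof (induction "length xs" arbitrary: xs ys rule: less_induct)
  case (less xs)
  have "icpt xs \<le> icpt ys \<or> (\<exists>S1 S2 Z. xs = S1 @ S2 \<and> S1 \<noteq> [] \<and> mset Z = mset S2 \<and> icpt (Z @ S1) \<le> icpt ys)"
    using swap_opt_contiguous_or_last[of xs "{#}" ys] less.prems by simp
  then show ?case
  proof (elim disjE exE conjE)
    fix S1 S2 Z assume *: "xs = S1 @ S2" "S1 \<noteq> []" "mset Z = mset S2" "icpt (Z @ S1) \<le> icpt ys"
    have "swap_opt S2" unfolding swap_opt_def
    proof (intro allI impI)
      fix P U V Q assume "S2 = P @ U @ V @ Q"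
      then show "cr U V \<ge> 0" using less.prems(1) *(1) by (intro swap_optD[of "S1 @ P" U V Q]) simp
    qed
    then have "icpt S2 \<le> icpt Z" using less.hyps[of S2 Z] less.prems(2) * by auto
    moreover have "slope S1 > 0" using less.prems(2) *(1) by (intro slope_pos) auto
    ultimately have "icpt (S2 @ S1) \<le> icpt (Z @ S1)" by simp
    moreover have "cr S1 S2 \<ge> 0" by (rule swap_optD[of "[]" _ _ "[]"]) (use less.prems(1) * in simp)
    then have "icpt xs \<le> icpt (S2 @ S1)" using icpt_swap[of "[]" S2 S1 "[]"] *(1) by simp
    ultimately show ?thesis using *(4) by linarith
  qed
qed

subsection \<open>Vanishing slopes\<close>

lemma tendsto_slope_icpt:
  assumes "\<And>i. i \<in> set xs \<Longrightarrow> ((\<lambda>e. h e i) \<longlongrightarrow> f i) F"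
  shows "((\<lambda>e. slope (map (h e) xs)) \<longlongrightarrow> slope (map f xs)) F \<and>
    ((\<lambda>e. icpt (map (h e) xs)) \<longlongrightarrow> icpt (map f xs)) F"
  using assms by (induction xs) (auto intro!: tendsto_intros)

lemma slope_nonneg: "(\<And>p. p \<in> set xs \<Longrightarrow> fst p \<ge> 0) \<Longrightarrow> slope xs \<ge> 0"
  by (induction xs) auto

lemma finite_bounded_above: "finite A \<Longrightarrow> \<exists>K. \<forall>x \<in> A. (g x :: real) \<le> K"
  by (meson Max_ge finite_imageI imageI)

lemma value_increases:
  assumes "\<forall>p \<in> set xs. fst p \<ge> 0 \<and> fst p * q + snd p \<ge> q"
  shows "slope xs * q + icpt xs \<ge> q"
  using assms
proof (induction xs)
  case (Cons p xs)
  have "slope xs \<ge> 0" using Cons.prems by (intro slope_nonneg) auto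
  then have "slope xs * (fst p * q + snd p) \<ge> slope xs * q"
    using Cons.prems by (intro mult_left_mono) auto
  moreover have "slope xs * q + icpt xs \<ge> q" using Cons by simp
  ultimately show ?case by (simp add: algebra_simps)
qed simp

text \<open>The swap changes the intercept by \<open>slope Q * cr U V\<close>, so local optimality
  determines a sign only if \<open>slope Q\<close> does not vanish.\<close>

definition weak_swap_opt :: "(real \<times> real) list \<Rightarrow> bool" where
  "weak_swap_opt xs \<longleftrightarrow> (\<forall>P U V Q. xs = P @ U @ V @ Q \<and> slope Q > 0 \<longrightarrow> cr U V \<ge> 0)"

lemma weak_swap_optD: "weak_swap_opt (P @ U @ V @ Q) \<Longrightarrow> slope Q > 0 \<Longrightarrow> cr U V \<ge> 0"
  by (auto simp: weak_swap_opt_def)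

text \<open>The vector of \<open>(e, (1 - e) * b)\<close> is \<open>1 - e\<close> times that of the
  constant \<open>b\<close>, so the vector of the whole block is a combination of the vectors of
  \<open>(0, b) # U\<close> and \<open>U\<close>.\<close>

lemma cr_near_constant:
  "cr ((e, (1 - e) * b) # U) V = (1 - e) * cr ((0, b) # U) V + e * cr U V"
  by (simp add: cr_def algebra_simps)

text \<open>Giving the constant slope \<open>e\<close> makes all slopes positive, so the merging
  argument applies to \<open>k # T\<close> with \<open>P\<close> as extra elements. Both outcomes
  bound the perturbed intercept of \<open>js\<close> below by \<open>L - e * K\<close>; then
  \<open>e\<close> tends to 0. Distinct indices ensure that only \<open>k\<close> is perturbed, even
  if pairs coincide.\<close>

lemma constant_head_minimal_of_strict_increase:
  fixes h :: "'a \<Rightarrow> real \<times> real"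
  assumes dist: "distinct (P @ k # T)" and hk: "h k = (0, b)"
    and pos: "\<forall>i \<in> set P \<union> set T. fst (h i) > 0"
    and opt: "weak_swap_opt (map h (k # T))"
    and up: "\<forall>T1 T2. \<forall>i \<in> set P. T = T1 @ T2 \<longrightarrow>
      fst (h i) * icpt (map h (k # T1)) + snd (h i) > icpt (map h (k # T1))"
    and js: "mset js = mset (P @ k # T)"
  shows "icpt (map h (k # T)) \<le> icpt (map h js)"
proof -
  define L where "L = icpt (map h (k # T))"
  define he where "he e = h (k := (e, (1 - e) * b))" for e
  define R where "R = mset (map h P)"
  have posT: "slope (map h B) > 0" if "set B \<subseteq> set P \<union> set T" for B
    using pos that by (intro slope_pos) auto
  have he: "map (he e) B = map h B" if "k \<notin> set B" for e B
    using that by (auto simp: he_def)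
  have kPT: "k \<notin> set P" "k \<notin> set T" using dist by auto
  \<comment> \<open>Moving \<open>T2\<close> in front of the constant erases its effect, so the swap
    compares \<open>L\<close> with the value reached after \<open>T1\<close>.\<close>
  have Lq: "L \<le> icpt (map h (k # T1))" if T: "T = T1 @ T2" for T1 T2
  proof -
    have "cr (map h (k # T1)) (map h T2) \<ge> 0"
      by (rule weak_swap_optD[of "[]" _ _ "[]"]) (use opt T in simp_all)
    then show ?thesis using T by (simp add: L_def cr_def hk algebra_simps)
  qed
  have opte: "swap_opt ((e, (1 - e) * b) # map h T)" if e: "0 < e" "e < 1" for e
    unfolding swap_opt_def
  proof (intro allI impI)
    fix A U V B
    assume eq: "(e, (1 - e) * b) # map h T = A @ U @ V @ B"
    consider Z where "map h T = Z @ U @ V @ B" | "U = []"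
      | Z where "U = (e, (1 - e) * b) # Z" "map h T = Z @ V @ B"
      using eq by (cases A; cases U) auto
    then show "cr U V \<ge> 0"
    proof cases
      case (1 Z)
      then have "set B \<subseteq> h ` set T" by (metis list.set_map set_append le_sup_iff order_refl)
      then have "slope B > 0" using pos by (intro slope_pos) auto
      then show ?thesis using opt 1 by (intro weak_swap_optD[of "h k # Z" _ _ B]) simp_all
    next
      case (3 Z)
      then have "set B \<subseteq> h ` set T" by (metis list.set_map set_append le_sup_iff order_refl)
      then have B: "slope B > 0" using pos by (intro slope_pos) auto
      have "cr ((0, b) # Z) V \<ge> 0" "cr Z V \<ge> 0"
        using opt 3 B hk by (auto intro: weak_swap_optD[of "[]" _ _ B] weak_swap_optD[of "[(0, b)]" _ _ B])
      then show ?thesis unfolding 3 cr_near_constant using e by simp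
    qed simp
  qed
  \<comment> \<open>At \<open>e = 0\<close> the strict increase says that these determinants are
    negative; this persists for small \<open>e\<close>, uniformly over finitely many
    \<open>n\<close> and \<open>i\<close>.\<close>
  have down: "\<forall>\<^sub>F e in at_right 0. \<forall>n \<in> {..length T}. \<forall>i \<in> set P.
      cr ((e, (1 - e) * b) # map h (take n T)) [h i] \<le> 0"
  proof (intro eventually_ball_finite ballI)
    fix n i assume i: "i \<in> set P"
    let ?U = "map h (take n T)"
    have "((\<lambda>e. (1 - e) * cr ((0, b) # ?U) [h i] + e * cr ?U [h i]) \<longlongrightarrow>
        (1 - 0) * cr ((0, b) # ?U) [h i] + 0 * cr ?U [h i]) (at_right 0)"
      by (intro tendsto_intros)
    moreover have "cr ((0, b) # ?U) [h i] < 0"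
      using up[rule_format, OF i, of "take n T" "drop n T"] by (simp add: cr_def hk algebra_simps)
    ultimately have "\<forall>\<^sub>F e in at_right 0. (1 - e) * cr ((0, b) # ?U) [h i] + e * cr ?U [h i] < 0"
      by (intro order_tendstoD(2)) auto
    then show "\<forall>\<^sub>F e in at_right 0. cr ((e, (1 - e) * b) # ?U) [h i] \<le> 0"
      by eventually_elim (simp only: cr_near_constant less_imp_le)
  qed auto
  \<comment> \<open>Finitely many lists can occur around the perturbed constant, so one
    \<open>K\<close> bounds the coefficient of \<open>e\<close> in all arrangements.\<close>
  define F where "F = {xs. set xs \<subseteq> h ` (set P \<union> set T) \<and> length xs \<le> length P + length T}"
  have finF: "finite F" unfolding F_def by (intro finite_lists_length_le) auto
  obtain K where K: "\<forall>(U, X, Y) \<in> F \<times> F \<times> F. slope U * slope Y * (b - icpt X) \<le> K"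
    using finite_bounded_above[of "F \<times> F \<times> F" "\<lambda>(U, X, Y). slope U * slope Y * (b - icpt X)"] finF
    by auto
  have lower: "L - e * K \<le> icpt (map (he e) js)"
    if e: "0 < e" "e < 1" and dn: "\<forall>n \<in> {..length T}. \<forall>i \<in> set P.
      cr ((e, (1 - e) * b) # map h (take n T)) [h i] \<le> 0" for e
  proof -
    let ?c = "(e, (1 - e) * b)"
    let ?S = "?c # map h T"
    have bound: "L - e * K \<le> L + e * (slope U * slope Y * (icpt X - b))"
      if "U \<in> F" "X \<in> F" "Y \<in> F" for U X Y
    proof -
      have "e * (slope U * slope Y * (b - icpt X)) \<le> e * K"
        using K that e by (intro mult_left_mono) auto
      then show ?thesis by (simp add: algebra_simps)
    qed
    have "map (he e) (P @ k # T) = map h P @ ?S"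
      using he kPT by (simp add: he_def)
    then have "mset (map (he e) js) = mset ?S + R"
      using js by (metis R_def mset_append mset_map add.commute)
    moreover have "\<forall>S1 S2. \<forall>r \<in># R. ?S = S1 @ S2 \<and> S1 \<noteq> [] \<longrightarrow> cr S1 [r] \<le> 0"
    proof (intro allI ballI impI)
      fix S1 S2 r assume "r \<in># R" and "?S = S1 @ S2 \<and> S1 \<noteq> []"
      then obtain i S1' where i: "i \<in> set P" "r = h i" and S1': "S1 = ?c # S1'" "map h T = S1' @ S2"
        by (cases S1) (auto simp: R_def)
      have "S1' = map h (take (length S1') T)" using S1'(2) by (simp add: take_map[symmetric])
      moreover have "length S1' \<le> length T" using arg_cong[OF S1'(2), of length] by simp
      ultimately show "cr S1 [r] \<le> 0" using dn i S1' by (metis atMost_iff)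
    qed
    moreover have "\<forall>p \<in> set ?S. fst p > 0" "\<forall>p \<in># R. fst p > 0"
      using pos e by (auto simp: R_def)
    ultimately have "(\<exists>X Y. mset (X @ Y) = R \<and> icpt (X @ ?S @ Y) \<le> icpt (map (he e) js)) \<or>
      (\<exists>S1 S2 Z. ?S = S1 @ S2 \<and> S1 \<noteq> [] \<and> mset Z = mset S2 + R \<and> icpt (Z @ S1) \<le> icpt (map (he e) js))"
      by (intro swap_opt_contiguous_or_last opte e)
    then show ?thesis
    proof (elim disjE exE conjE)
      fix X Y assume XY: "mset (X @ Y) = R" "icpt (X @ ?S @ Y) \<le> icpt (map (he e) js)"
      have "set (X @ Y) = h ` set P" using XY(1) by (metis R_def list.set_map set_mset_mset)
      moreover have "length (X @ Y) = length P" using XY(1) by (metis R_def length_map size_mset)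
      ultimately have F: "X \<in> F" "Y \<in> F" "map h T \<in> F" by (auto simp: F_def)
      \<comment> \<open>Functions of \<open>P\<close> applied after \<open>T\<close> do not lower
        the value \<open>L\<close>.\<close>
      have "slope Y * L + icpt Y \<ge> L"
      proof (rule value_increases, intro ballI)
        fix p assume "p \<in> set Y"
        with \<open>set (X @ Y) = h ` set P\<close> obtain i where i: "i \<in> set P" "p = h i" by auto
        then show "0 \<le> fst p \<and> L \<le> fst p * L + snd p"
          using pos up[rule_format, OF i(1), of T "[]"] by (auto simp: L_def less_imp_le)
      qed
      moreover have "icpt (X @ ?S @ Y) =
          slope Y * L + icpt Y + e * (slope (map h T) * slope Y * (icpt X - b))"
        by (simp add: L_def hk algebra_simps)
      ultimately show ?thesis using bound[OF F(3,1,2)] XY(2) by linarith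
    next
      fix S1 S2 Z assume *: "?S = S1 @ S2" "S1 \<noteq> []" "mset Z = mset S2 + R"
        "icpt (Z @ S1) \<le> icpt (map (he e) js)"
      then obtain S1' where S1': "S1 = ?c # S1'" "map h T = S1' @ S2" by (cases S1) auto
      obtain T1 T2 where T: "T = T1 @ T2" "S1' = map h T1" "S2 = map h T2"
        using S1'(2) by (metis map_eq_append_conv)
      have "set Z = set S2 \<union> h ` set P" using *(3)
        by (metis R_def list.set_map set_mset_mset set_mset_union)
      moreover have "length Z = length S2 + length P" using *(3)
        by (metis R_def length_map size_mset size_union)
      ultimately have F: "Z \<in> F" "[] \<in> F" "S1' \<in> F" using T by (auto simp: F_def)
      have "icpt (Z @ S1) = icpt (map h (k # T1)) + e * (slope S1' * slope [] * (icpt Z - b))"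
        by (simp add: S1'(1) T hk algebra_simps)
      then show ?thesis using bound[OF F(3,1,2)] *(4) Lq[OF T(1)] by linarith
    qed
  qed
  have "\<forall>\<^sub>F e::real in at_right 0. 0 < e \<and> e < 1"
    unfolding eventually_at_right_field by (intro exI[of _ 1]) auto
  with down have ev: "\<forall>\<^sub>F e in at_right 0. L - e * K \<le> icpt (map (he e) js)"
    by eventually_elim (use lower in blast)
  have "((\<lambda>e. icpt (map (he e) js)) \<longlongrightarrow> icpt (map h js)) (at_right 0)"
  proof (rule tendsto_slope_icpt[THEN conjunct2])
    fix i
    have "((\<lambda>e. (e, (1 - e) * b)) \<longlongrightarrow> (0, (1 - 0) * b)) (at_right 0)" by (intro tendsto_intros)
    then show "((\<lambda>e. he e i) \<longlongrightarrow> h i) (at_right 0)"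
      by (cases "i = k") (simp_all add: he_def hk)
  qed
  moreover have "((\<lambda>e. L - e * K) \<longlongrightarrow> L - 0 * K) (at_right 0)"
    by (intro tendsto_intros)
  ultimately have "L - 0 * K \<le> icpt (map h js)"
    using ev by (intro tendsto_le[of "at_right (0::real)"]) auto
  then show ?thesis by (simp add: L_def)
qed

text \<open>If a slope vanishes, split at the last constant \<open>k\<close>. Functions before
  \<open>k\<close> do not affect the result, but by local optimality they lower no value along
  \<open>T\<close>; a small perturbation makes them raise these values strictly, and the limit gives
  the claim.\<close>

theorem weak_swap_opt_imp_minimal:
  fixes f :: "'a \<Rightarrow> real \<times> real"
  assumes dist: "distinct is" and nonneg: "\<forall>i \<in> set is. fst (f i) \<ge> 0"
    and opt: "weak_swap_opt (map f is)" and js: "mset js = mset is"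
  shows "icpt (map f is) \<le> icpt (map f js)"
proof (cases "\<exists>i \<in> set is. fst (f i) = 0")
  case False
  then have "\<forall>i \<in> set is. fst (f i) > 0" using nonneg by (metis less_eq_real_def)
  then have pos: "\<forall>p \<in> set (map f is). fst p > 0" by simp
  have "swap_opt (map f is)"
    unfolding swap_opt_def
  proof (intro allI impI)
    fix A U V B assume eq: "map f is = A @ U @ V @ B"
    then have "slope B > 0" using pos by (intro slope_pos) auto
    then show "cr U V \<ge> 0" using opt eq by (intro weak_swap_optD[of A U V B]) simp_all
  qed
  then show ?thesis using pos js by (intro swap_opt_imp_minimal) simp_all
next
  case True
  then obtain P k T where split: "is = P @ k # T" and k0: "fst (f k) = 0"
    and T0: "\<forall>i \<in> set T. fst (f i) \<noteq> 0"
    using split_list_last_prop[of "is" "\<lambda>i. fst (f i) = 0"] by blast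
  define b where "b = snd (f k)"
  have fk: "f k = (0, b)" using k0 by (simp add: b_def prod_eq_iff)
  have posT: "\<forall>i \<in> set T. fst (f i) > 0"
    using T0 nonneg unfolding split by (metis in_set_conv_decomp less_eq_real_def append_assoc append_Cons)
  have kPT: "k \<notin> set P" "k \<notin> set T" "set P \<inter> set T = {}" using dist split by auto
  define q where "q n = icpt (map f (k # take n T))" for n
  obtain K where K: "\<forall>n \<in> {..length T}. - q n \<le> K"
    using finite_bounded_above[of "{..length T}" "\<lambda>n. - q n"] by auto
  \<comment> \<open>This makes \<open>x + M\<close> positive for every value \<open>x\<close> along
    \<open>T\<close>, so adding \<open>e * (x + M)\<close> to the function strictly raises it
    there.\<close>
  define M where "M = K + 1"
  define h where "h e i = (if i \<in> set P then (fst (f i) + e, snd (f i) + e * M) else f i)" for e i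
  have hkT: "map (h e) (k # B) = map f (k # B)" if "set B \<subseteq> set T" for e B
    using that kPT by (auto simp: h_def)
  have strict: "icpt (map f (k # T)) \<le> icpt (map (h e) js)" if e: "e > 0" for e
  proof -
    have "icpt (map (h e) (k # T)) \<le> icpt (map (h e) js)"
    proof (rule constant_head_minimal_of_strict_increase)
      show "distinct (P @ k # T)" using dist split by simp
      show "mset js = mset (P @ k # T)" using js split by simp
      show "h e k = (0, b)" using kPT fk by (simp add: h_def)
      show "\<forall>i \<in> set P \<union> set T. fst (h e i) > 0"
        using posT nonneg split e by (auto simp: h_def add_nonneg_pos)
      show "weak_swap_opt (map (h e) (k # T))" unfolding hkT[OF order_refl] weak_swap_opt_def
      proof (intro allI impI)
        fix A U V B assume "map f (k # T) = A @ U @ V @ B \<and> slope B > 0"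
        then show "cr U V \<ge> 0"
          using opt split by (intro weak_swap_optD[of "map f P @ A" U V B]) simp_all
      qed
      show "\<forall>T1 T2. \<forall>i \<in> set P. T = T1 @ T2 \<longrightarrow>
        fst (h e i) * icpt (map (h e) (k # T1)) + snd (h e i) > icpt (map (h e) (k # T1))"
      proof (intro allI ballI impI)
        fix T1 T2 i assume i: "i \<in> set P" and T: "T = T1 @ T2"
        obtain P1 P2 where P: "P = P1 @ i # P2" using i by (meson split_list)
        define x where "x = icpt (map f (k # T1))"
        have "x = q (length T1)" by (simp add: x_def q_def T)
        then have "x + M > 0" using K[rule_format, of "length T1"] T by (simp add: M_def)
        have "slope (map f T2) > 0" using posT T by (intro slope_pos) auto
        \<comment> \<open>Swapping \<open>i\<close> behind \<open>P2 @ k # T1\<close> applies it to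
          the value \<open>x\<close>, because the constant \<open>k\<close> erases
          \<open>P2\<close>.\<close>
        then have "cr [f i] (map f (P2 @ k # T1)) \<ge> 0"
          using opt split P T by (intro weak_swap_optD[of "map f P1" _ _ "map f T2"]) simp_all
        then have "fst (f i) * x + snd (f i) \<ge> x"
          by (simp add: cr_def x_def fk algebra_simps)
        moreover have "e * (x + M) > 0" using e \<open>x + M > 0\<close> by simp
        ultimately have "fst (h e i) * x + snd (h e i) > x"
          using i by (simp add: h_def algebra_simps)
        moreover have "map (h e) (k # T1) = map f (k # T1)" using T by (intro hkT) simp
        ultimately show "fst (h e i) * icpt (map (h e) (k # T1)) + snd (h e i) > icpt (map (h e) (k # T1))"
          by (simp only: x_def)
      qed
    qed
    then show ?thesis unfolding hkT[OF order_refl] .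
  qed
  have "((\<lambda>e. icpt (map (h e) js)) \<longlongrightarrow> icpt (map f js)) (at_right 0)"
  proof (rule tendsto_slope_icpt[THEN conjunct2])
    fix i
    have "((\<lambda>e. (fst (f i) + e, snd (f i) + e * M)) \<longlongrightarrow>
        (fst (f i) + 0, snd (f i) + 0 * M)) (at_right 0)"
      by (intro tendsto_intros)
    then show "((\<lambda>e. h e i) \<longlongrightarrow> f i) (at_right 0)"
      by (cases "i \<in> set P") (simp_all add: h_def)
  qed
  moreover have "\<forall>\<^sub>F e in at_right 0. icpt (map f (k # T)) \<le> icpt (map (h e) js)"
    unfolding eventually_at_right_field using strict by (intro exI[of _ 1]) auto
  ultimately have "icpt (map f (k # T)) \<le> icpt (map f js)"
    by (intro tendsto_lowerbound[of _ _ "at_right (0::real)"]) auto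
  moreover have "icpt (map f is) = icpt (map f (k # T))" by (simp add: split fk)
  ultimately show ?thesis by simp
qed

subsection \<open>From lists to permutations\<close>

lemma comp_perm_eq:
  "comp_perm a b n s x =
    slope (map (\<lambda>i. (a i, b i)) (map s [1..<n+1])) * x + icpt (map (\<lambda>i. (a i, b i)) (map s [1..<n+1]))"
  unfolding foldl_linear[symmetric] comp_perm_def by (simp add: foldl_map)

lemma mset_map_permutes:
  assumes "s permutes {1..n}"
  shows "mset (map s [1..<n+1]) = mset [1..<n+1]"
proof -
  have "mset (map s [1..<n+1]) = image_mset s (mset_set {1..<n+1})"
    by (simp only: mset_map mset_upt)
  also have "\<dots> = mset_set (s ` {1..<n+1})"
    using assms by (intro image_mset_mset_set inj_on_subset[OF permutes_inj]) auto
  also have "s ` {1..<n+1} = {1..<n+1}"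
    using permutes_image[OF assms] by (simp add: atLeastLessThanSuc_atLeastAtMost)
  finally show ?thesis by (simp only: mset_upt)
qed

text \<open>Positions count from 1, so \<open>U\<close> occupies \<open>length P + 1\<close> to
  \<open>length P + length U\<close> and \<open>V\<close> follows directly.\<close>

lemma map_block_swap:
  assumes "map s [1..<n+1] = P @ U @ V @ Q"
  shows "map (block_swap s (length P + 1) (length P + length U) (length P + length U + length V)) [1..<n+1]
    = P @ V @ U @ Q"
proof -
  have len: "n = length P + length U + length V + length Q"
    using arg_cong[OF assms, of length] by (simp del: upt_Suc)
  have s: "s (i + 1) = (P @ U @ V @ Q) ! i" if "i < n" for i
    unfolding assms[symmetric] using that by (simp del: upt_Suc)
  show ?thesis
  proof (rule nth_equalityI)
    fix i assume "i < length (map (block_swap s (length P + 1) (length P + length U) (length P + length U + length V)) [1..<n+1])"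
    then have i: "i < n" by (simp del: upt_Suc)
    have "map (block_swap s (length P + 1) (length P + length U) (length P + length U + length V)) [1..<n+1] ! i
      = block_swap s (length P + 1) (length P + length U) (length P + length U + length V) (i + 1)"
      using i by (simp del: upt_Suc)
    also have "\<dots> = (P @ V @ U @ Q) ! i"
    proof -
      consider "i < length P" | "length P \<le> i" "i < length P + length V"
        | "length P + length V \<le> i" "i < length P + length U + length V"
        | "length P + length U + length V \<le> i" by linarith
      then show ?thesis
      proof cases
        case 1
        then show ?thesis using s[OF i] by (simp add: block_swap_def nth_append)
      next
        case 2
        then obtain d where d: "i = length P + d" "d < length V"
          by (metis le_Suc_ex nat_add_left_cancel_less)
        have "s (length P + length U + d + 1) = V ! d"
          using s[of "length P + length U + d"] d len by (simp add: nth_append)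
        then show ?thesis using d by (simp add: block_swap_def nth_append add_ac)
      next
        case 3
        then obtain d where d: "i = length P + length V + d" "d < length U"
          by (metis le_Suc_ex nat_add_left_cancel_less add.commute add.left_commute)
        have "s (length P + d + 1) = U ! d"
          using s[of "length P + d"] d len by (simp add: nth_append)
        then show ?thesis using d by (simp add: block_swap_def nth_append add_ac)
      next
        case 4
        then obtain d where d: "i = length P + length U + length V + d"
          by (metis le_Suc_ex)
        have "s (i + 1) = Q ! d" using s[OF i] d by (simp add: nth_append)
        then show ?thesis using d by (simp add: block_swap_def nth_append)
      qed
    qed
    finally show "map (block_swap s (length P + 1) (length P + length U) (length P + length U + length V)) [1..<n+1] ! i
      = (P @ V @ U @ Q) ! i" .
  qed (simp add: len del: upt_Suc)
qed

text \<open>The value list of the block swap rearranges that of \<open>s\<close>, hence is a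
  duplicate-free listing of \<open>{1..n}\<close>; outside this set the swap agrees with
  \<open>s\<close>.\<close>

lemma permutes_block_swap:
  assumes s: "s permutes {1..n}" and "1 \<le> l" "l \<le> m" "m < r" "r \<le> n"
  shows "block_swap s l m r permutes {1..n}"
proof -
  define xs where "xs = map s [1..<n+1]"
  have len: "length xs = n" by (simp add: xs_def)
  define P where "P = take (l - 1) xs"
  define U where "U = take (m + 1 - l) (drop (l - 1) xs)"
  define V where "V = take (r - m) (drop m xs)"
  define Q where "Q = drop r xs"
  have "V @ Q = drop m xs"
    unfolding V_def Q_def using append_take_drop_id[of "r - m" "drop m xs"] assms by simp
  moreover have "U @ drop m xs = drop (l - 1) xs"
    unfolding U_def using append_take_drop_id[of "m + 1 - l" "drop (l - 1) xs"] assms by simp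
  ultimately have split: "xs = P @ U @ V @ Q" by (simp add: P_def)
  have "length P + 1 = l" "length P + length U = m" "length P + length U + length V = r"
    using assms len by (simp_all add: P_def U_def V_def)
  then have map: "map (block_swap s l m r) [1..<n+1] = P @ V @ U @ Q"
    using map_block_swap[of s n P U V Q] split unfolding xs_def by simp
  have "mset (map (block_swap s l m r) [1..<n+1]) = mset [1..<n+1]"
    unfolding map mset_map_permutes[OF s, symmetric] split[unfolded xs_def] by simp
  then have "distinct (map (block_swap s l m r) [1..<n+1])"
    and "set (map (block_swap s l m r) [1..<n+1]) = set [1..<n+1]"
    by (metis distinct_upt mset_eq_imp_distinct_iff, metis set_mset_mset)
  then have "bij_betw (block_swap s l m r) {1..n} {1..n}"
    by (simp add: bij_betw_def distinct_map atLeastLessThanSuc_atLeastAtMost del: upt_Suc)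
  then show ?thesis
  proof (rule bij_imp_permutes)
    fix i assume "i \<notin> {1..n}"
    then show "block_swap s l m r i = i"
      using assms permutes_not_in[OF s] by (auto simp: block_swap_def)
  qed
qed

theorem mainTheorem17:
  fixes a b :: "nat \<Rightarrow> real" and n :: nat and s :: "nat \<Rightarrow> nat"
  assumes nondecr: "\<And>i. i \<in> {1..n} \<Longrightarrow> a i \<ge> 0"
    and perm: "s permutes {1..n}"
  shows "is_minimum a b n s \<longleftrightarrow> locally_optimal a b n s"
proof
  assume "is_minimum a b n s"
  then show "locally_optimal a b n s"
    unfolding is_minimum_def locally_optimal_def using permutes_block_swap[OF perm] by blast
next
  assume loc: "locally_optimal a b n s"
  define f where "f i = (a i, b i)" for i
  define xs where "xs = map s [1..<n+1]"
  \<comment> \<open>All orders share one slope, so the pointwise comparison reduces to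
    intercepts.\<close>
  have slope_eq: "slope (map f (map r [1..<n+1])) = slope (map f xs)" if "r permutes {1..n}" for r
    unfolding xs_def using mset_map_permutes[OF that] mset_map_permutes[OF perm]
    by (intro slope_mset) (metis mset_map)
  have opt: "weak_swap_opt (map f xs)"
    unfolding weak_swap_opt_def
  proof (intro allI impI, elim conjE)
    fix P U V Q assume eq: "map f xs = P @ U @ V @ Q" and Q: "slope Q > 0"
    show "cr U V \<ge> 0"
    \<comment> \<open>\<open>locally_optimal\<close> speaks of nonempty blocks only; for an empty
      one \<open>cr\<close> is zero.\<close>
    proof (cases "U = [] \<or> V = []")
      case True
      then show ?thesis by (elim disjE) simp_all
    next
      case False
      from eq obtain P' U' V' Q' where xs: "xs = P' @ U' @ V' @ Q'"
        and m: "P = map f P'" "U = map f U'" "V = map f V'" "Q = map f Q'"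
        by (auto simp: map_eq_append_conv append_eq_map_conv)
      let ?r = "block_swap s (length P' + 1) (length P' + length U') (length P' + length U' + length V')"
      have len: "n = length P' + length U' + length V' + length Q'"
        using arg_cong[OF xs, of length] by (simp add: xs_def del: upt_Suc)
      have "U' \<noteq> []" "V' \<noteq> []" using False m by auto
      then have "comp_perm a b n s 0 \<le> comp_perm a b n ?r 0"
        using loc len unfolding locally_optimal_def by (auto simp: Suc_le_eq)
      moreover have r: "map ?r [1..<n+1] = P' @ V' @ U' @ Q'"
        using map_block_swap xs unfolding xs_def by blast
      have "comp_perm a b n s 0 = icpt (P @ U @ V @ Q)"
        unfolding comp_perm_eq f_def[symmetric] xs_def[symmetric] xs m map_append
        by (simp only: mult_zero_right add_0)
      moreover have "comp_perm a b n ?r 0 = icpt (P @ V @ U @ Q)"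
        unfolding comp_perm_eq f_def[symmetric] r m map_append
        by (simp only: mult_zero_right add_0)
      ultimately have "icpt (P @ U @ V @ Q) \<le> icpt (P @ V @ U @ Q)" by (simp only:)
      then have "slope Q * cr U V \<ge> 0" using icpt_swap[of P V U Q] by linarith
      then show ?thesis using Q by (simp add: zero_le_mult_iff)
    qed
  qed
  show "is_minimum a b n s"
    unfolding is_minimum_def
  proof (intro allI impI)
    fix r x assume r: "r permutes {1..n}"
    have "icpt (map f xs) \<le> icpt (map f (map r [1..<n+1]))"
    proof (rule weak_swap_opt_imp_minimal[OF _ _ opt])
      show "mset (map r [1..<n+1]) = mset xs"
        unfolding xs_def mset_map_permutes[OF r] mset_map_permutes[OF perm] ..
      then show "distinct xs"
        unfolding xs_def mset_map_permutes[OF r] by (metis distinct_upt mset_eq_imp_distinct_iff)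
      have "set xs = {1..n}" unfolding xs_def
        using permutes_image[OF perm] by (simp add: atLeastLessThanSuc_atLeastAtMost del: upt_Suc)
      then show "\<forall>i \<in> set xs. fst (f i) \<ge> 0" using nondecr by (simp add: f_def)
    qed
    then show "comp_perm a b n s x \<le> comp_perm a b n r x"
      unfolding comp_perm_eq f_def[symmetric] slope_eq[OF r] xs_def[symmetric] by simp
  qed
qed

end
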